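(* The map $\theta:\tilde{\mathcal D}\to\mathcal A_\infty(\Delta)$, $\theta(f)=\frac{d}{dz}\log f_z=\frac{f_{zz}}{f_z}$, is injective.
   Context: $\Delta$ is the open unit disc. $\tilde{\mathcal D}$ is the set of univalent functions $f:\Delta\to\mathbb C$ with $f(0)=0$, $f'(0)=1$ which have a quasiconformal extension to $\mathbb C$ (a model of the universal Teichmüller curve). $\mathcal A_\infty(\Delta)$ is the Banach space of holomorphic $\psi$ on $\Delta$ with $\sup_{z\in\Delta}|\psi(z)(1-|z|^2)|<\infty$; $\theta(f)$ lies in it for $f\in\tilde{\mathcal D}$ by the classical distortion theorem. *)

theory Defs
  imports "HOL-Complex_Analysis.Complex_Analysis"
begin

abbreviation unit_disc :: "complex set" (\<open>\<Delta>\<close>) where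
  "\<Delta> \<equiv> ball 0 1"

(* Epsilon-delta definition.  A finite family of non-overlapping subintervals of {a..b} is
   encoded as a division of its union; a member k = {u..v} has u = Inf k and
   v = Sup k. *)
definition absolutely_continuous_on_interval ::
    "real \<Rightarrow> real \<Rightarrow> (real \<Rightarrow> complex) \<Rightarrow> bool" where
  "absolutely_continuous_on_interval a b h \<longleftrightarrow>
     (\<forall>\<epsilon>>0. \<exists>\<delta>>0. \<forall>d t. d division_of t \<and> t \<subseteq> {a..b} \<and> (\<Sum>k\<in>d. Sup k - Inf k) < \<delta> \<longrightarrow>
        (\<Sum>k\<in>d. cmod (h (Sup k) - h (Inf k))) < \<epsilon>)"

(* ACL: in every closed rectangle contained in S, absolutely continuous on almost every
   horizontal and almost every vertical segment. *)
definition absolutely_continuous_on_lines :: "complex set \<Rightarrow> (complex \<Rightarrow> complex) \<Rightarrow> bool" where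
  "absolutely_continuous_on_lines S F \<longleftrightarrow>
     (\<forall>a b. cbox a b \<subseteq> S \<longrightarrow>
        (AE y in lebesgue. y \<in> {Im a..Im b} \<longrightarrow>
           absolutely_continuous_on_interval (Re a) (Re b) (\<lambda>x. F (Complex x y))) \<and>
        (AE x in lebesgue. x \<in> {Re a..Re b} \<longrightarrow>
           absolutely_continuous_on_interval (Im a) (Im b) (\<lambda>y. F (Complex x y))))"

(* The analytic definition of a quasiconformal homeomorphism from the open set S onto T.
   With p = F_x and q = F_y, the Wirtinger derivatives are F_z = (p - i q) / 2 and
   F_zbar = (p + i q) / 2.  The bound with k < 1 makes the Jacobian nonnegative a.e., so the
   maps are orientation preserving. *)
definition quasiconformal_map ::
    "complex set \<Rightarrow> complex set \<Rightarrow> (complex \<Rightarrow> complex) \<Rightarrow> bool" where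
  "quasiconformal_map S T F \<longleftrightarrow>
     open S \<and> (\<exists>G. homeomorphism S T F G) \<and> absolutely_continuous_on_lines S F \<and>
     (\<exists>k. 0 \<le> k \<and> k < 1 \<and>
        (AE z in lebesgue. z \<in> S \<longrightarrow>
           (\<exists>p q. ((\<lambda>t. F (z + of_real t)) has_vector_derivative p) (at 0) \<and>
                  ((\<lambda>t. F (z + \<i> * of_real t)) has_vector_derivative q) (at 0) \<and>
                  cmod ((p + \<i> * q) / 2) \<le> k * cmod ((p - \<i> * q) / 2))))"

(* Functions on the disc are represented by functions on the whole type that take the value
   undefined off the disc, so that equality of representatives is equality on the disc. *)
definition D_tilde :: "(complex \<Rightarrow> complex) set" where
  "D_tilde = {f \<in> extensional \<Delta>. f holomorphic_on \<Delta> \<and> inj_on f \<Delta> \<and> f 0 = 0 \<and> deriv f 0 = 1 \<and>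
     (\<exists>F. quasiconformal_map UNIV UNIV F \<and> (\<forall>z\<in>\<Delta>. F z = f z))}"

definition A_infinity :: "(complex \<Rightarrow> complex) set" where
  "A_infinity = {\<psi> \<in> extensional \<Delta>. \<psi> holomorphic_on \<Delta> \<and>
     bdd_above ((\<lambda>z. cmod (\<psi> z * of_real (1 - (cmod z)\<^sup>2))) ` \<Delta>)}"

definition theta :: "(complex \<Rightarrow> complex) \<Rightarrow> complex \<Rightarrow> complex" where
  "theta f = (\<lambda>z\<in>\<Delta>. deriv (deriv f) z / deriv f z)"

end

theory Submission
  imports Defs
begin

text \<open>
  A normalised univalent function \<open>f\<close> omits a value \<open>a\<close> with \<open>|a| < 2\<close>, by the Schwarz lemma
  applied to the inverse function. A holomorphic square root of \<open>1 - f/a\<close> then omits 0, and since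
  \<open>1 - f/a\<close> takes the value 1 only at the origin, one of the two roots also omits 1. Schottky's
  theorem bounds that root, hence \<open>f\<close>, near the origin by an absolute constant, and Cauchy's
  inequality bounds \<open>f''(0)\<close>. Rescaling to the largest disc around a point of \<open>\<Delta>\<close> gives the
  growth bound on \<open>f''/f'\<close> without the sharp distortion theorem. Injectivity holds because
  \<open>f''/f' = g''/g'\<close> makes \<open>f'/g'\<close> constant.
\<close>

lemma univalent_omits_value:
  assumes holf: "f holomorphic_on ball 0 1" and inj: "inj_on f (ball 0 1)"
    and f0: "f 0 = 0" and df0: "deriv f 0 = 1"
  obtains a where "cmod a < 2" "a \<notin> f ` ball 0 1"
proof -
  have False if sub: "ball 0 2 \<subseteq> f ` ball 0 1"
  proof -
    obtain g where holg: "g holomorphic_on f ` ball 0 1"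
      and dg: "\<And>z. z \<in> ball 0 1 \<Longrightarrow> deriv f z * deriv g (f z) = 1"
      and gf: "\<And>z. z \<in> ball 0 1 \<Longrightarrow> g (f z) = z"
      using holomorphic_has_inverse[OF holf open_ball inj] by blast
    have hol2: "g holomorphic_on ball 0 2"
      using holg sub holomorphic_on_subset by blast
    have g0: "g 0 = 0" "deriv g 0 = 1"
      using gf[of 0] dg[of 0] f0 df0 by auto
    \<comment> \<open>\<open>k\<close> is a self-map of the unit disc fixing 0 with derivative 2
      there, which contradicts Schwarz. Any radius above 1 in place of 2 would give the same
      contradiction.\<close>
    define k where "k = (\<lambda>z. g (2 * z))"
    have "k holomorphic_on ball 0 1"
      unfolding k_def
      by (rule holomorphic_on_compose_gen[OF _ hol2, unfolded o_def])
         (auto intro!: holomorphic_intros simp: norm_mult)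
    moreover have "cmod (k z) < 1" if "cmod z < 1" for z
    proof -
      have "2 * z \<in> f ` ball 0 1"
        using sub that by (auto simp: norm_mult)
      then show ?thesis
        using gf by (auto simp: k_def)
    qed
    ultimately have "cmod (deriv k 0) \<le> 1"
      using Schwarz_Lemma(2)[of k 0] g0 by (simp add: k_def)
    moreover have "g field_differentiable at (2 * 0)"
      using holomorphic_on_imp_differentiable_at[OF hol2 open_ball, of 0] by simp
    then have "deriv k 0 = 2"
      using deriv_compose_linear[of g 2 0] g0 by (simp add: k_def)
    ultimately show False by simp
  qed
  then show ?thesis
    using that by (auto simp: subset_iff)
qed

text \<open>\<open>B\<close> is chosen before \<open>f\<close>, so the bound is uniform over all
  normalised univalent functions. This uniformity is what makes the later rescaling
  possible.\<close>

lemma univalent_bounded_near_0: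
  obtains B where
    "\<And>f z. \<lbrakk>f holomorphic_on ball 0 1; inj_on f (ball 0 1); f 0 = 0; deriv f 0 = 1; cmod z \<le> 1/4\<rbrakk>
       \<Longrightarrow> cmod (f z) \<le> B"
proof -
  \<comment> \<open>Schottky's bound for a function of modulus at most 1 at the origin, on the disc
    of radius 1/2.\<close>
  define M :: real where "M = exp (pi * exp (pi * (2 + 2 * 1 + 12 * (1/2) / (1 - 1/2))))"
  have "cmod (f z) \<le> 2 * (1 + M\<^sup>2)"
    if holf: "f holomorphic_on ball 0 1" and inj: "inj_on f (ball 0 1)"
      and f0: "f 0 = 0" and df0: "deriv f 0 = 1" and z: "cmod z \<le> 1/4" for f z
  proof -
    obtain a where a: "cmod a < 2" "a \<notin> f ` ball 0 1"
      using univalent_omits_value[OF holf inj f0 df0] by blast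
    have a0: "a \<noteq> 0"
      using a(2) f0 by force
    define h where "h = (\<lambda>z. 1 - f z / a)"
    have "h holomorphic_on ball 0 1"
      unfolding h_def using a0 holf by (auto intro!: holomorphic_intros)
    moreover have "h w \<noteq> 0" if "w \<in> ball 0 1" for w
      using a(2) a0 that by (auto simp: h_def)
    ultimately obtain s where hols: "s holomorphic_on ball 0 1"
      and s: "\<And>w. w \<in> ball 0 1 \<Longrightarrow> h w = s w ^ 2"
      using contractible_imp_holomorphic_sqrt[of h "ball 0 1"] convex_imp_contractible[OF convex_ball]
      by metis
    have s0: "s 0 ^ 2 = 1"
      using s[of 0] f0 by (simp add: h_def)
    then have s0nz: "s 0 \<noteq> 0" by auto
    \<comment> \<open>Since \<open>s 0\<close> squares to 1, dividing by \<open>- s 0\<close> only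
      selects the root with value -1 at the origin. The argument \<open>w / 2\<close> makes
      \<open>q\<close> holomorphic on the closed unit disc, as Schottky requires. Evaluating
      \<open>q\<close> at \<open>2 * z\<close> within radius 1/2 then accounts for the radius
      1/4.\<close>
    define q where "q = (\<lambda>w. - s (w / 2) / s 0)"
    have q2: "q w ^ 2 = h (w / 2)" if "w \<in> cball 0 1" for w
      using that s[of "w / 2"] s0 by (simp add: q_def power_divide norm_divide)
    have "q holomorphic_on cball 0 1"
    proof -
      have "(\<lambda>w. s (w / 2)) holomorphic_on cball 0 1"
        by (rule holomorphic_on_compose_gen[OF _ hols, unfolded o_def])
           (auto intro!: holomorphic_intros simp: norm_divide)
      then show ?thesis
        unfolding q_def using s0nz by (auto intro!: holomorphic_intros)
    qed
    moreover have q0: "q 0 = -1"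
      using s0nz by (simp add: q_def)
    \<comment> \<open>If \<open>q w = 1\<close>, then \<open>h (w / 2) = 1\<close>, so injectivity
      of \<open>f\<close> forces \<open>w = 0\<close>, where \<open>q\<close> is -1 instead.\<close>
    moreover have "\<not> (q w = 0 \<or> q w = 1)" if w: "w \<in> cball 0 1" for w
    proof -
      have w2: "w / 2 \<in> ball 0 1"
        using w by (simp add: norm_divide)
      have "h (w / 2) \<noteq> 0"
        using a(2) a0 w2 by (auto simp: h_def)
      moreover have "w = 0" if "h (w / 2) = 1"
      proof -
        have "f (w / 2) = f 0"
          using that a0 f0 by (simp add: h_def)
        then show ?thesis
          using inj_onD[OF inj _ w2, of 0] by simp
      qed
      ultimately show ?thesis
        using q2[OF w] q0 by auto
    qed
    ultimately have "cmod (q (2 * z)) \<le> M"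
      unfolding M_def using z by (intro Schottky) (auto simp: norm_mult)
    then have "cmod (h z) \<le> M\<^sup>2"
      using q2[of "2 * z"] z power_mono[of "cmod (q (2 * z))" M 2]
      by (simp add: norm_mult flip: norm_power)
    moreover have "f z = a * (1 - h z)"
      using a0 by (simp add: h_def)
    moreover have "cmod (1 - h z) \<le> 1 + cmod (h z)"
      using norm_triangle_ineq4[of 1 "h z"] by simp
    ultimately show ?thesis
      using a(1) by (simp only: norm_mult) (intro mult_mono, auto)
  qed
  then show ?thesis using that by blast
qed

text \<open>The normalised function \<open>g z = (f (w + r * z) - f w) / (r * deriv f w)\<close> is
  univalent on the unit disc, and its second derivative at 0 is \<open>r\<close> times the quotient
  of \<open>deriv (deriv f) w\<close> by \<open>deriv f w\<close>. Hence \<open>C\<close> depends on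
  none of \<open>f\<close>, \<open>w\<close>, \<open>r\<close>.\<close>

lemma univalent_second_deriv_bound:
  obtains C where "0 \<le> C"
    "\<And>f w r. \<lbrakk>f holomorphic_on ball w r; inj_on f (ball w r); 0 < r\<rbrakk>
       \<Longrightarrow> r * cmod (deriv (deriv f) w) \<le> C * cmod (deriv f w)"
proof -
  obtain B where B: "\<And>f z. \<lbrakk>f holomorphic_on ball 0 1; inj_on f (ball 0 1); f 0 = 0; deriv f 0 = 1;
      cmod z \<le> 1/4\<rbrakk> \<Longrightarrow> cmod (f z) \<le> B"
    using univalent_bounded_near_0 by blast
  \<comment> \<open>The identity map is itself normalised and univalent, so its value at 0 shows
    that \<open>B\<close> is nonnegative.\<close>
  have "cmod 0 \<le> B"
    by (rule B[of "\<lambda>z. z"]) (auto intro!: holomorphic_intros)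
  then have "0 \<le> 32 * B" by simp
  \<comment> \<open>The factor 32 is \<open>fact 2 / (1/4) ^ 2\<close>, from Cauchy's inequality for
    the second derivative on radius 1/4.\<close>
  moreover have "r * cmod (deriv (deriv f) w) \<le> 32 * B * cmod (deriv f w)"
    if holf: "f holomorphic_on ball w r" and inj: "inj_on f (ball w r)" and r: "0 < r" for f w r
  proof -
    have df: "deriv f w \<noteq> 0"
      using holomorphic_injective_imp_regular[OF holf open_ball inj, of w] r by simp
    define c where "c = of_real r * deriv f w"
    have c: "c \<noteq> 0" using df r by (simp add: c_def)
    define p where "p = (\<lambda>z. f (of_real r * z + w))"
    have maps: "of_real r * z + w \<in> ball w r" if "z \<in> ball 0 1" for z
      using that r by (simp add: dist_norm norm_mult)
    have holp: "p holomorphic_on ball 0 1"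
      unfolding p_def
      by (rule holomorphic_on_compose_gen[OF _ holf, unfolded o_def])
         (use maps in \<open>auto intro!: holomorphic_intros\<close>)
    have dp: "(deriv ^^ n) p 0 = of_real r ^ n * (deriv ^^ n) f w" for n
      unfolding p_def
      using higher_deriv_compose_linear'[OF holf open_ball open_ball, of 0 0 1 "of_real r" w n] maps
      by simp
    define g where "g = (\<lambda>z. (p z - f w) * inverse c)"
    have holg: "g holomorphic_on ball 0 1"
      unfolding g_def using holp by (auto intro!: holomorphic_intros)
    have dg_eq: "deriv g z = deriv p z * inverse c" if "z \<in> ball 0 1" for z
    proof -
      have "(p has_field_derivative deriv p z) (at z)"
        using holp that holomorphic_derivI by blast
      then show ?thesis
        unfolding g_def by (auto intro!: DERIV_imp_deriv derivative_eq_intros)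
    qed
    have "deriv (deriv g) 0 = deriv (\<lambda>z. deriv p z * inverse c) 0"
    proof (rule deriv_cong_ev)
      show "\<forall>\<^sub>F z in nhds 0. deriv g z = deriv p z * inverse c"
        using dg_eq by (auto simp: eventually_nhds intro!: exI[of _ "ball 0 1"])
    qed simp
    also have "\<dots> = deriv (deriv p) 0 * inverse c"
    proof -
      have "deriv p holomorphic_on ball 0 1"
        using holp by (auto intro!: holomorphic_intros)
      then have "(deriv p has_field_derivative deriv (deriv p) 0) (at 0)"
        using holomorphic_derivI by force
      then show ?thesis
        by (auto intro!: DERIV_imp_deriv derivative_eq_intros)
    qed
    also have "\<dots> = of_real r * deriv (deriv f) w / deriv f w"
      using dp[of 2] r by (simp add: c_def eval_nat_numeral field_simps)
    finally have ddg: "deriv (deriv g) 0 = of_real r * deriv (deriv f) w / deriv f w" .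
    have bound: "cmod (g z) \<le> B" if "cmod z \<le> 1/4" for z
    proof (rule B[OF holg _ _ _ that])
      show "inj_on g (ball 0 1)"
      proof (rule inj_onI)
        fix x y assume xy: "x \<in> ball 0 1" "y \<in> ball 0 1" "g x = g y"
        then have "f (of_real r * x + w) = f (of_real r * y + w)"
          using c by (simp add: g_def p_def)
        then have "of_real r * x + w = of_real r * y + w"
          using inj_onD[OF inj] maps xy by blast
        then show "x = y" using r by simp
      qed
      show "g 0 = 0" by (simp add: g_def p_def)
      show "deriv g 0 = 1"
        using dg_eq[of 0] dp[of 1] df r by (simp add: c_def field_simps)
    qed
    have "cmod ((deriv ^^ 2) g 0) \<le> fact 2 * B / (1/4) ^ 2"
    proof (rule Cauchy_inequality)
      show "g holomorphic_on ball 0 (1/4)"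
        using holg by (rule holomorphic_on_subset) auto
      show "continuous_on (cball 0 (1/4)) g"
        using holg by (intro holomorphic_on_imp_continuous_on) (rule holomorphic_on_subset, auto)
    qed (auto intro: bound)
    then have "cmod (deriv (deriv g) 0) \<le> 32 * B"
      by (simp add: eval_nat_numeral)
    then show ?thesis
      using df r by (simp add: ddg norm_mult norm_divide divide_simps)
  qed
  ultimately show ?thesis using that by blast
qed

text \<open>The quotient \<open>f z / g z\<close> has derivative zero, hence is constant on the
  connected set. Working with the quotient avoids choosing branches of the logarithm.\<close>

lemma eq_if_log_deriv_eq:
  assumes S: "open S" "connected S" and z0: "z0 \<in> S"
    and f: "f holomorphic_on S" "\<And>z. z \<in> S \<Longrightarrow> f z \<noteq> 0"
    and g: "g holomorphic_on S" "\<And>z. z \<in> S \<Longrightarrow> g z \<noteq> 0"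
    and eq: "\<And>z. z \<in> S \<Longrightarrow> deriv f z / f z = deriv g z / g z"
    and eq0: "f z0 = g z0" and z: "z \<in> S"
  shows "f z = g z"
proof -
  have "((\<lambda>z. f z / g z) has_field_derivative 0) (at z)" if "z \<in> S" for z
  proof -
    have "(f has_field_derivative deriv f z) (at z)" "(g has_field_derivative deriv g z) (at z)"
      using f(1) g(1) S(1) that holomorphic_derivI by blast+
    then have "((\<lambda>z. f z / g z) has_field_derivative
        (deriv f z * g z - f z * deriv g z) / (g z * g z)) (at z)"
      using g(2)[OF that] by (rule DERIV_divide)
    moreover have "deriv f z * g z - f z * deriv g z = 0"
      using eq[OF that] f(2)[OF that] g(2)[OF that] by (simp add: field_simps)
    ultimately show ?thesis by simp
  qed
  moreover have "continuous_on S (\<lambda>z. f z / g z)"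
    using f(1) g by (intro continuous_intros holomorphic_on_imp_continuous_on) auto
  ultimately obtain c where c: "\<And>z. z \<in> S \<Longrightarrow> f z / g z = c"
    using DERIV_zero_connected_constant[OF S(2,1) finite.emptyI, of "\<lambda>z. f z / g z"] by blast
  have "c = 1"
    using c[OF z0] eq0 g(2)[OF z0] by simp
  then show ?thesis
    using c[OF z] g(2)[OF z] by simp
qed

lemma D_tildeD:
  assumes "f \<in> D_tilde"
  shows "f \<in> extensional \<Delta>" "f holomorphic_on \<Delta>" "inj_on f \<Delta>" "f 0 = 0" "deriv f 0 = 1"
    "deriv f holomorphic_on \<Delta>" "z \<in> \<Delta> \<Longrightarrow> deriv f z \<noteq> 0"
proof -
  show f: "f \<in> extensional \<Delta>" "f holomorphic_on \<Delta>" "inj_on f \<Delta>" "f 0 = 0" "deriv f 0 = 1"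
    using assms by (auto simp: D_tilde_def)
  show "deriv f holomorphic_on \<Delta>"
    using f(2) open_ball by (rule holomorphic_deriv)
  show "deriv f z \<noteq> 0" if "z \<in> \<Delta>"
    using f(2) open_ball f(3) that by (rule holomorphic_injective_imp_regular)
qed

lemma theta_in_A_infinity:
  assumes f: "f \<in> D_tilde"
  shows "theta f \<in> A_infinity"
proof -
  note f = D_tildeD[OF f]
  obtain C where C: "0 \<le> C" "\<And>f w r. \<lbrakk>f holomorphic_on ball w r; inj_on f (ball w r); 0 < r\<rbrakk>
       \<Longrightarrow> r * cmod (deriv (deriv f) w) \<le> C * cmod (deriv f w)"
    using univalent_second_deriv_bound by blast
  have "(\<lambda>z. deriv (deriv f) z / deriv f z) holomorphic_on \<Delta>"
    using f(7) by (intro holomorphic_on_divide holomorphic_deriv[OF f(6)] f(6)) auto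
  then have hol: "theta f holomorphic_on \<Delta>"
    by (rule holomorphic_transform) (simp add: theta_def)
  \<comment> \<open>The largest disc around \<open>w\<close> inside the unit disc has radius
    \<open>1 - cmod w\<close>. The remaining factor \<open>1 + cmod w\<close> of the weight is at
    most 2.\<close>
  have "cmod (theta f w * of_real (1 - (cmod w)\<^sup>2)) \<le> 2 * C" if w: "w \<in> \<Delta>" for w
  proof -
    have nw: "cmod w < 1" using w by simp
    have sub: "ball w (1 - cmod w) \<subseteq> \<Delta>"
      using ball_subset_ball_iff[of w "1 - cmod w" 0 1] by simp
    have "(1 - cmod w) * cmod (deriv (deriv f) w) \<le> C * cmod (deriv f w)"
      using holomorphic_on_subset[OF f(2) sub] inj_on_subset[OF f(3) sub] nw by (intro C(2)) auto
    then have *: "(1 - cmod w) * cmod (theta f w) \<le> C"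
      using f(7)[OF w] w by (simp add: theta_def norm_divide divide_simps)
    have "cmod (theta f w * of_real (1 - (cmod w)\<^sup>2)) = cmod (theta f w) * \<bar>1 - (cmod w)\<^sup>2\<bar>"
      by (simp only: norm_mult norm_of_real)
    also have "\<bar>1 - (cmod w)\<^sup>2\<bar> = (1 + cmod w) * (1 - cmod w)"
      using nw by (simp add: abs_square_le_1 power2_eq_square algebra_simps mult_le_one)
    also have "cmod (theta f w) * \<dots> = (1 + cmod w) * ((1 - cmod w) * cmod (theta f w))"
      by simp
    also have "\<dots> \<le> 2 * C"
      using nw * by (intro mult_mono) auto
    finally show ?thesis .
  qed
  then show ?thesis
    using hol by (auto simp: A_infinity_def theta_def intro!: bdd_aboveI2)
qed

text \<open>Two integrations recover \<open>f\<close> from \<open>theta f\<close>: the first fixes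
  \<open>deriv f\<close> up to a factor, the second \<open>f\<close> up to a summand. The
  normalisations of \<open>deriv f 0\<close> and \<open>f 0\<close> determine these two
  constants.\<close>

lemma inj_on_theta: "inj_on theta D_tilde"
proof (rule inj_onI)
  fix f g assume D: "f \<in> D_tilde" "g \<in> D_tilde" and eq: "theta f = theta g"
  note f = D_tildeD[OF D(1)] and g = D_tildeD[OF D(2)]
  have deq: "deriv f z = deriv g z" if "z \<in> \<Delta>" for z
  proof (rule eq_if_log_deriv_eq[of \<Delta> 0 "deriv f" "deriv g"])
    show "deriv (deriv f) z / deriv f z = deriv (deriv g) z / deriv g z" if "z \<in> \<Delta>" for z
      using fun_cong[OF eq, of z] that by (simp add: theta_def)
  qed (use f g that in auto)
  have "((\<lambda>z. f z - g z) has_field_derivative 0) (at z within \<Delta>)" if "z \<in> \<Delta>" for z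
    using DERIV_diff[OF holomorphic_derivI[OF f(2) open_ball that]
        holomorphic_derivI[OF g(2) open_ball that]] deq[OF that]
    by (simp add: has_field_derivative_at_within)
  then obtain c where c: "\<And>z. z \<in> \<Delta> \<Longrightarrow> f z - g z = c"
    using has_field_derivative_zero_constant[OF convex_ball, of 0 1 "\<lambda>z. f z - g z"] by blast
  have "c = 0"
    using c[of 0] f(4) g(4) by simp
  \<comment> \<open>Off the disc both functions take the value \<open>undefined\<close>, so
    agreement on the disc gives equality.\<close>
  then show "f = g"
    using c by (intro extensionalityI[OF f(1) g(1)]) auto
qed

theorem lemmaA1:
  shows "theta \<in> D_tilde \<rightarrow> A_infinity \<and> inj_on theta D_tilde"
  using theta_in_A_infinity inj_on_theta by blast

end
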